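(* Let $d=3$ and let two prediction pipelines carry the same source-level statistical model to the quiescent analogy along paths whose relative holonomy is $D=\rho\begin{pmatrix}1&0\\0&R\end{pmatrix}$ with $\rho>0$, $R\in SO(3)$; that is, if pipeline 1 uses the stationary random source $s_1$ then pipeline 2 uses $s_2=\rho^{-2}\,s_1\circ D^{-1}$. Then their far-field directivities are related exactly by $$I_2(\boldsymbol n,\omega)=I_1(R^{\mathrm T}\boldsymbol n,\ \rho\,\omega)$$ for every unit vector $\boldsymbol n$ and every frequency $\omega$: a rigid rotation of the directivity pattern by $R$ together with a rigid dilation of the spectrum by $\rho$. In particular predicted spectral peaks differ by exactly the factor $\rho$ (a peak at $\omega_0$ in pipeline 1 becomes a peak at $\omega_0/\rho$ in pipeline 2).
   Context: Fix $c>0$; coordinates $\xi=(t,\boldsymbol x)\in\mathbb R^{1+3}$. The quiescent analogy is $\Box p=s$, $\Box=\partial_t^2-c^2\Delta$. A holonomy is a linear map of $\mathbb R^{1+3}$ of the form $D=\rho\begin{pmatrix}1&0\\0&R\end{pmatrix}$ with $\rho>0$ and $R\in SO(3)$, i.e. $D(t,\boldsymbol x)=(\rho t,\rho R\boldsymbol x)$; it acts on sources by $s\mapsto s'=\rho^{-2}s\circ D^{-1}$ (the source for which $p'=p\circ D^{-1}$ satisfies $\Box p'=s'$). For a stationary random source $s_i$ the correlation is $R_{s_i}(\zeta)=\langle s_i(\xi)s_i(\xi+\zeta)\rangle$ (assumed integrable), and the wavenumber--frequency spectrum is $\Phi_i(\omega,\boldsymbol k)=\int R_{s_i}(\zeta)\,e^{-\mathrm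 i\kappa\cdot\zeta}\,d\zeta$ with $\kappa\cdot\zeta=\boldsymbol k\cdot\boldsymbol x-\omega t$ for $\zeta=(t,\boldsymbol x)$. The far-field pressure spectral density in the quiescent medium is taken to sample the source spectrum on the sonic sphere, $S_{pp}(r\boldsymbol n,\omega)=\frac{K}{r^2}\Phi(\omega,\frac{\omega}{c}\boldsymbol n)$ as $r\to\infty$, with $K>0$ a fixed convention constant, so that the directivity of pipeline $i$ is $I_i(\boldsymbol n,\omega)=\lim_{r\to\infty}r^2S_{pp}(r\boldsymbol n,\omega)=K\,\Phi_i(\omega,\frac{\omega}{c}\boldsymbol n)$. *)

theory Defs
  imports "HOL-Probability.Probability" "HOL-Library.Landau_Symbols"
begin

type_synonym spacetime = "real \<times> (real^3)"

definition holonomy :: "real \<Rightarrow> real^3^3 \<Rightarrow> spacetime \<Rightarrow> spacetime" where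
  "holonomy \<rho> R = (\<lambda>(t, x). (\<rho> * t, \<rho> *\<^sub>R (R *v x)))"

type_synonym 'w random_source = "spacetime \<Rightarrow> 'w \<Rightarrow> real"

text \<open>If the wave equation holds for a pressure \<open>p\<close> with source \<open>s\<close>, then it holds for
  \<open>p \<circ> D\<^sup>-\<^sup>1\<close> with the source below, where \<open>D = holonomy \<rho> R\<close>.\<close>

definition holonomy_act :: "real \<Rightarrow> real^3^3 \<Rightarrow> 'w random_source \<Rightarrow> 'w random_source" where
  "holonomy_act \<rho> R s = (\<lambda>\<xi> w. inverse (\<rho>\<^sup>2) * s (inv (holonomy \<rho> R) \<xi>) w)"

text \<open>Stationarity is meant in the wide sense; every strictly stationary source with finite
  second moments is covered.\<close>

definition stationary_source :: "'w measure \<Rightarrow> 'w random_source \<Rightarrow> bool" where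
  "stationary_source M s \<longleftrightarrow>
     (\<forall>\<xi>. s \<xi> \<in> borel_measurable M \<and> integrable M (\<lambda>w. (s \<xi> w)\<^sup>2)) \<and>
     (\<forall>\<xi> \<eta>. (LINT w|M. s \<xi> w) = (LINT w|M. s \<eta> w)) \<and>
     (\<forall>\<xi> \<eta> \<zeta>. (LINT w|M. s \<xi> w * s (\<xi> + \<zeta>) w) = (LINT w|M. s \<eta> w * s (\<eta> + \<zeta>) w))"

text \<open>For a stationary source this is the common value of the two-point averages over all base
  points \<open>\<xi>\<close>; it is unspecified if they do not agree.\<close>

definition correlation :: "'w measure \<Rightarrow> 'w random_source \<Rightarrow> spacetime \<Rightarrow> real" where
  "correlation M s \<zeta> = (THE r. \<forall>\<xi>. (LINT w|M. s \<xi> w * s (\<xi> + \<zeta>) w) = r)"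

definition spectrum :: "'w measure \<Rightarrow> 'w random_source \<Rightarrow> real \<Rightarrow> real^3 \<Rightarrow> complex" where
  "spectrum M s \<omega> k =
     (LINT \<zeta>|lborel. complex_of_real (correlation M s \<zeta>) *
        exp (- (\<i> * complex_of_real (k \<bullet> snd \<zeta> - \<omega> * fst \<zeta>))))"

text \<open>\<open>S x \<omega>\<close> is a pressure spectral density at position \<open>x\<close>; its far field is
  \<open>K / r\<^sup>2\<close> times the source spectrum on the sonic sphere, up to an error \<open>o(1 / r\<^sup>2)\<close>.
  The source spectrum is complex-valued by definition, but real for stationary real sources,
  since then the correlation is even.\<close>

definition sonic_far_field ::
    "real \<Rightarrow> real \<Rightarrow> (real \<Rightarrow> real^3 \<Rightarrow> complex) \<Rightarrow> (real^3 \<Rightarrow> real \<Rightarrow> real) \<Rightarrow> bool" where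
  "sonic_far_field c K \<Phi> S \<longleftrightarrow>
     (\<forall>n \<omega>. norm n = 1 \<longrightarrow>
        (\<lambda>r. complex_of_real (S (r *\<^sub>R n) \<omega>)
               - complex_of_real (K / r\<^sup>2) * \<Phi> \<omega> ((\<omega> / c) *\<^sub>R n))
          \<in> o[at_top](\<lambda>r. complex_of_real (1 / r\<^sup>2)))"

definition directivity :: "(real^3 \<Rightarrow> real \<Rightarrow> real) \<Rightarrow> real^3 \<Rightarrow> real \<Rightarrow> real" where
  "directivity S n \<omega> = Lim at_top (\<lambda>r. r\<^sup>2 * S (r *\<^sub>R n) \<omega>)"

definition local_peak :: "(real \<Rightarrow> real) \<Rightarrow> real \<Rightarrow> bool" where
  "local_peak f \<omega>\<^sub>0 \<longleftrightarrow> (\<forall>\<^sub>F \<omega> in at \<omega>\<^sub>0. f \<omega> \<le> f \<omega>\<^sub>0)"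

definition strict_local_peak :: "(real \<Rightarrow> real) \<Rightarrow> real \<Rightarrow> bool" where
  "strict_local_peak f \<omega>\<^sub>0 \<longleftrightarrow> (\<forall>\<^sub>F \<omega> in at \<omega>\<^sub>0. f \<omega> < f \<omega>\<^sub>0)"

definition global_peak :: "(real \<Rightarrow> real) \<Rightarrow> real \<Rightarrow> bool" where
  "global_peak f \<omega>\<^sub>0 \<longleftrightarrow> (\<forall>\<omega>. f \<omega> \<le> f \<omega>\<^sub>0)"

end

theory Submission
  imports Defs
begin

text \<open>The correlation of the transformed source is \<open>\<rho>\<^sup>-\<^sup>4\<close> times the original one, composed with
  \<open>D\<^sup>-\<^sup>1\<close>. Substituting along \<open>D\<close> in the Fourier integral contributes the Jacobian \<open>\<rho>\<^sup>4\<close> (spacetime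
  has dimension four, and a rotation preserves volume), so the two factors cancel and the spectrum
  is merely evaluated at the transposed covector \<open>(\<rho>\<omega>, \<rho>R\<^sup>Tk)\<close>, which lies on the sonic cone
  whenever \<open>(\<omega>, k)\<close> does.\<close>

text \<open>Lebesgue measure is determined by its values on boxes. The preimage of a box under
  \<open>f\<close> is its image under \<open>inv f\<close>, which is again orthogonal and hence
  preserves volume.\<close>

lemma distr_lborel_orthogonal_transformation:
  fixes f :: "real^'n::{finite,wellorder} \<Rightarrow> real^'n::_"
  assumes f: "orthogonal_transformation f"
  shows "distr lborel borel f = lborel"
proof (rule lborel_eqI[symmetric])
  have meas: "f \<in> borel \<rightarrow>\<^sub>M borel"
    using f by (intro borel_measurable_continuous_onI linear_continuous_on)
      (simp add: linear_linear orthogonal_transformation_linear)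
  fix l u :: "real^'n::_"
  assume lu: "\<And>b. b \<in> Basis \<Longrightarrow> l \<bullet> b \<le> u \<bullet> b"
  have g: "orthogonal_transformation (inv f)"
    using f by (rule orthogonal_transformation_inv)
  have "bij f" using f by (rule orthogonal_transformation_bij)
  then have vim: "f -` box l u = inv f ` box l u"
    by (simp add: bij_vimage_eq_inv_image)
  have box: "box l u \<in> lmeasurable" by simp
  have "emeasure (distr lborel borel f) (box l u) = emeasure lborel (f -` box l u)"
    using meas by (subst emeasure_distr) auto
  also have "\<dots> = emeasure lebesgue (inv f ` box l u)"
  proof -
    \<comment> \<open>\<open>lborel\<close> and its completion agree on Borel sets, so the preimage
      has to be Borel before its measure can be computed in \<open>lebesgue\<close>.\<close>
    have "f -` box l u \<in> sets borel"
      using measurable_sets[OF meas, of "box l u"] by simp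
    then show ?thesis by (simp add: vim)
  qed
  also have "\<dots> = measure lebesgue (inv f ` box l u)"
    using measurable_orthogonal_image[OF g box] by (rule emeasure_eq_measure2)
  also have "\<dots> = measure lebesgue (box l u)"
    by (simp only: measure_orthogonal_image[OF g box])
  also have "\<dots> = (\<Prod>b\<in>Basis. (u - l) \<bullet> b)"
    using lu by (simp add: measure_lborel_box_eq)
  finally show "emeasure (distr lborel borel f) (box l u) = (\<Prod>b\<in>Basis. (u - l) \<bullet> b)" .
qed simp

lemma measurable_holonomy: "holonomy \<rho> R \<in> borel \<rightarrow>\<^sub>M borel"
  unfolding holonomy_def case_prod_beta
  by (intro borel_measurable_continuous_onI continuous_intros
      continuous_on_compose2[OF matrix_vector_mult_linear_continuous_on]) auto

text \<open>A holonomy is a rotation of space followed by a uniform dilation of spacetime. The first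
  preserves the product measure, and the second scales it by \<rho> to the power 1 + 3.\<close>

lemma lborel_holonomy:
  assumes "\<rho> > 0" "orthogonal_matrix R"
  shows "lborel = density (distr lborel borel (holonomy \<rho> R)) (\<lambda>_. ennreal (\<rho> ^ 4))"
proof -
  let ?h = "\<lambda>(t, x). (t, R *v x) :: spacetime"
  have orth: "orthogonal_transformation ((*v) R)"
    using assms by (simp add: orthogonal_transformation_matrix matrix_vector_mul_linear)
  note distr_R = distr_lborel_orthogonal_transformation[OF orth]
  have meas: "(*v) R \<in> borel \<rightarrow>\<^sub>M borel"
    by (intro borel_measurable_continuous_onI matrix_vector_mult_linear_continuous_on)
  \<comment> \<open>Time is pushed forward along the identity, so that the product rule for
    pushforwards applies to both factors at once.\<close>
  have "distr lborel borel (\<lambda>x. x) \<Otimes>\<^sub>M distr lborel borel ((*v) R)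
      = distr (lborel \<Otimes>\<^sub>M lborel) (borel \<Otimes>\<^sub>M borel) ?h"
    using meas by (intro pair_measure_distr) (auto simp: distr_R sigma_finite_lborel)
  then have "distr lborel borel ?h = (lborel :: spacetime measure)"
    by (simp add: distr_R distr_id2 lborel_prod borel_prod)
  moreover have "holonomy \<rho> R = (\<lambda>x. \<rho> *\<^sub>R x) \<circ> ?h"
    by (auto simp: holonomy_def fun_eq_iff)
  moreover have "?h \<in> borel \<rightarrow>\<^sub>M borel"
    using measurable_holonomy[of 1 R] by (simp add: holonomy_def)
  ultimately have "distr lborel borel (holonomy \<rho> R) = distr lborel borel (\<lambda>x. \<rho> *\<^sub>R x)"
    using distr_distr[of "\<lambda>x. \<rho> *\<^sub>R x" borel borel ?h lborel] by simp
  then show ?thesis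
    using lborel_affine[of \<rho> "0 :: spacetime"] assms by simp
qed

text \<open>Change of variables along the holonomy. Integrability passes between the two sides;
  where it fails, both integrals are the default 0.\<close>

lemma integral_holonomy:
  fixes f :: "spacetime \<Rightarrow> 'b::{banach, second_countable_topology}"
  assumes "\<rho> > 0" "orthogonal_matrix R" and f: "f \<in> borel_measurable borel"
  shows "(LINT \<zeta>|lborel. f \<zeta>) = \<rho> ^ 4 *\<^sub>R (LINT \<zeta>|lborel. f (holonomy \<rho> R \<zeta>))"
proof -
  have "(LINT \<zeta>|lborel. f \<zeta>)
      = (LINT \<zeta>|density (distr lborel borel (holonomy \<rho> R)) (\<lambda>_. ennreal (\<rho> ^ 4)). f \<zeta>)"
    using lborel_holonomy[OF assms(1,2)] by simp
  also have "\<dots> = \<rho> ^ 4 *\<^sub>R (LINT \<zeta>|lborel. f (holonomy \<rho> R \<zeta>))"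
    using f \<open>\<rho> > 0\<close> measurable_holonomy[of \<rho> R]
    by (subst integral_density) (auto simp: integral_distr)
  finally show ?thesis .
qed

text \<open>Since \<open>R\<close> is orthogonal, its transpose inverts it. The inverse is thus a
  holonomy too, so measurability and additivity carry over to it.\<close>

lemma inv_holonomy:
  assumes "\<rho> > 0" "orthogonal_matrix R"
  shows "inv (holonomy \<rho> R) = holonomy (inverse \<rho>) (transpose R)"
    and "inv (holonomy \<rho> R) (holonomy \<rho> R \<zeta>) = \<zeta>"
proof -
  have left: "holonomy (inverse \<rho>) (transpose R) (holonomy \<rho> R \<zeta>) = \<zeta>" for \<zeta>
    using assms by (cases \<zeta>)
      (simp add: holonomy_def orthogonal_matrix_def matrix_vector_mult_scaleR
        matrix_vector_mul_assoc del: transpose_matrix_vector)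
  have right: "holonomy \<rho> R (holonomy (inverse \<rho>) (transpose R) \<zeta>) = \<zeta>" for \<zeta>
    using assms by (cases \<zeta>)
      (simp add: holonomy_def orthogonal_matrix_def matrix_vector_mult_scaleR
        matrix_vector_mul_assoc del: transpose_matrix_vector)
  show eq: "inv (holonomy \<rho> R) = holonomy (inverse \<rho>) (transpose R)"
    using left right by (intro inv_unique_comp) (auto simp: fun_eq_iff)
  show "inv (holonomy \<rho> R) (holonomy \<rho> R \<zeta>) = \<zeta>"
    by (simp add: eq left)
qed

lemma holonomy_add: "holonomy \<rho> R (\<xi> + \<zeta>) = holonomy \<rho> R \<xi> + holonomy \<rho> R \<zeta>"
  by (cases \<xi>, cases \<zeta>) (simp add: holonomy_def algebra_simps)

text \<open>Stationarity makes the two-point average independent of the base point, so the definite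
  description in \<open>correlation\<close> denotes it.\<close>

lemma correlation_eq:
  assumes "stationary_source M s"
  shows "(LINT w|M. s \<xi> w * s (\<xi> + \<zeta>) w) = correlation M s \<zeta>"
proof -
  have "\<And>\<eta>. (LINT w|M. s \<eta> w * s (\<eta> + \<zeta>) w) = (LINT w|M. s \<xi> w * s (\<xi> + \<zeta>) w)"
    using assms unfolding stationary_source_def by blast
  then show ?thesis
    unfolding correlation_def by (intro the_equality[symmetric]) (auto simp del: split_paired_All)
qed

text \<open>Each of the two source factors contributes \<open>inverse (\<rho>\<^sup>2)\<close>, and
  by linearity the inverse holonomy acts on the separation alone. The resulting average does not
  depend on the base point, so the transformed source has a well-defined correlation.\<close>

lemma correlation_holonomy_act:
  assumes "\<rho> > 0" "orthogonal_matrix R" "stationary_source M s"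
  shows "correlation M (holonomy_act \<rho> R s) \<zeta>
    = inverse (\<rho> ^ 4) * correlation M s (inv (holonomy \<rho> R) \<zeta>)"
proof -
  let ?G = "inv (holonomy \<rho> R)"
  have "(LINT w|M. holonomy_act \<rho> R s \<xi> w * holonomy_act \<rho> R s (\<xi> + \<zeta>) w)
      = inverse (\<rho> ^ 4) * correlation M s (?G \<zeta>)" for \<xi>
  proof -
    have "holonomy_act \<rho> R s \<xi> w * holonomy_act \<rho> R s (\<xi> + \<zeta>) w
        = inverse (\<rho> ^ 4) * (s (?G \<xi>) w * s (?G \<xi> + ?G \<zeta>) w)" for w
      using assms(1,2)
      by (simp add: holonomy_act_def inv_holonomy(1) holonomy_add field_simps flip: power_add)
    then show ?thesis
      by (simp add: correlation_eq[OF assms(3)])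
  qed
  then show ?thesis
    unfolding correlation_def[of M "holonomy_act \<rho> R s"] by (intro the_equality) auto
qed

lemma spectrum_holonomy_act:
  assumes "\<rho> > 0" "orthogonal_matrix R" "stationary_source M s"
    and meas: "correlation M s \<in> borel_measurable borel"
  shows "spectrum M (holonomy_act \<rho> R s) \<omega> k
    = spectrum M s (\<rho> * \<omega>) (\<rho> *\<^sub>R (transpose R *v k))"
proof -
  let ?D = "holonomy \<rho> R"
  let ?E = "\<lambda>\<omega> k \<zeta>::spacetime. exp (- (\<i> * complex_of_real (k \<bullet> snd \<zeta> - \<omega> * fst \<zeta>)))"
  let ?f = "\<lambda>\<zeta>. complex_of_real (correlation M (holonomy_act \<rho> R s) \<zeta>) * ?E \<omega> k \<zeta>"
  have "inv ?D \<in> borel \<rightarrow>\<^sub>M borel"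
    using assms(1,2) by (simp add: inv_holonomy(1) measurable_holonomy)
  then have [measurable]: "correlation M (holonomy_act \<rho> R s) \<in> borel_measurable borel"
    unfolding correlation_holonomy_act[OF assms(1-3), abs_def]
    by (intro borel_measurable_times borel_measurable_const measurable_compose[OF _ meas])
  have [measurable]: "?E \<omega> k \<in> borel_measurable borel"
    by (intro borel_measurable_continuous_onI continuous_intros)
  \<comment> \<open>Moving \<open>R\<close> across the inner product is what turns the rotation of
    space into the transposed rotation of the wavevector.\<close>
  have "k \<bullet> (R *v x) = (transpose R *v k) \<bullet> x" for x
    by (simp add: dot_lmul_matrix[symmetric])
  then have phase: "?E \<omega> k (?D \<zeta>) = ?E (\<rho> * \<omega>) (\<rho> *\<^sub>R (transpose R *v k)) \<zeta>" for \<zeta>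
    by (cases \<zeta>) (simp add: holonomy_def algebra_simps)
  have "spectrum M (holonomy_act \<rho> R s) \<omega> k = \<rho> ^ 4 *\<^sub>R (LINT \<zeta>|lborel. ?f (?D \<zeta>))"
    unfolding spectrum_def by (intro integral_holonomy assms) measurable
  \<comment> \<open>At \<open>?D \<zeta>\<close> the inverse holonomy in the correlation cancels;
    only its amplitude factor and the transformed phase remain.\<close>
  also have "(LINT \<zeta>|lborel. ?f (?D \<zeta>))
      = (LINT \<zeta>|lborel. complex_of_real (inverse (\<rho> ^ 4)) *
          (complex_of_real (correlation M s \<zeta>) * ?E (\<rho> * \<omega>) (\<rho> *\<^sub>R (transpose R *v k)) \<zeta>))"
    unfolding phase correlation_holonomy_act[OF assms(1-3)] inv_holonomy(2)[OF assms(1,2)]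
    by (simp add: mult.assoc)
  also have "\<rho> ^ 4 *\<^sub>R \<dots> = spectrum M s (\<rho> * \<omega>) (\<rho> *\<^sub>R (transpose R *v k))"
    using \<open>\<rho> > 0\<close> unfolding spectrum_def integral_mult_right_zero
    by (simp add: scaleR_conv_of_real)
  finally show ?thesis .
qed

text \<open>Dividing the error by \<open>1 / r\<^sup>2\<close> makes it tend to 0. As
  \<open>S\<close> is real-valued, the limit is read off from the real part of the complex
  relation.\<close>

lemma directivity_sonic:
  assumes "sonic_far_field c K \<Phi> S" "norm n = 1"
  shows "directivity S n \<omega> = K * Re (\<Phi> \<omega> ((\<omega> / c) *\<^sub>R n))"
proof -
  let ?\<Phi> = "\<Phi> \<omega> ((\<omega> / c) *\<^sub>R n)"
  let ?e = "\<lambda>r. complex_of_real (S (r *\<^sub>R n) \<omega>) - complex_of_real (K / r\<^sup>2) * ?\<Phi>"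
  have "?e \<in> o[at_top](\<lambda>r. complex_of_real (1 / r\<^sup>2))"
    using assms unfolding sonic_far_field_def by blast
  then have "((\<lambda>r. ?e r / complex_of_real (1 / r\<^sup>2)) \<longlongrightarrow> 0) at_top"
    by (rule smalloD_tendsto)
  then have "((\<lambda>r. Re (?e r / complex_of_real (1 / r\<^sup>2))) \<longlongrightarrow> Re 0) at_top"
    by (rule tendsto_Re)
  moreover have "\<forall>\<^sub>F r in at_top. Re (?e r / complex_of_real (1 / r\<^sup>2))
      = r\<^sup>2 * S (r *\<^sub>R n) \<omega> - K * Re ?\<Phi>"
    \<comment> \<open>Cancelling \<open>1 / r\<^sup>2\<close> requires r to be nonzero, which holds
      eventually.\<close>
    using eventually_gt_at_top[of 0]
  proof eventually_elim
    case (elim r)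
    have "?e r / complex_of_real (1 / r\<^sup>2) = of_real (r\<^sup>2 * S (r *\<^sub>R n) \<omega>) - of_real K * ?\<Phi>"
      using elim by (simp add: field_simps)
    then show ?case by simp
  qed
  ultimately have "((\<lambda>r. r\<^sup>2 * S (r *\<^sub>R n) \<omega> - K * Re ?\<Phi>) \<longlongrightarrow> 0) at_top"
    by (simp add: filterlim_cong)
  then have "((\<lambda>r. r\<^sup>2 * S (r *\<^sub>R n) \<omega>) \<longlongrightarrow> K * Re ?\<Phi>) at_top"
    by (rule LIM_zero_cancel)
  then show ?thesis
    unfolding directivity_def by (intro tendsto_Lim) auto
qed

text \<open>Multiplication by a nonzero scalar is a homeomorphism, and by injectivity it matches the
  punctured neighbourhoods of \<open>z / a\<close> with those of \<open>z\<close>.\<close>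

lemma eventually_at_rescale:
  fixes a :: "'a::real_normed_field"
  assumes "a \<noteq> 0"
  shows "(\<forall>\<^sub>F x in at (z / a). P (a * x)) \<longleftrightarrow> (\<forall>\<^sub>F y in at z. P y)"
proof
  assume "\<forall>\<^sub>F x in at (z / a). P (a * x)"
  moreover have "filterlim (\<lambda>y. y / a) (at (z / a)) (at z)"
    using assms by (intro filterlim_atI tendsto_intros) (auto simp: eventually_at_filter)
  ultimately show "\<forall>\<^sub>F y in at z. P y"
    using assms by (auto dest: eventually_compose_filterlim)
next
  assume "\<forall>\<^sub>F y in at z. P y"
  moreover have "((*) a \<longlongrightarrow> a * (z / a)) (at (z / a))"
    by (intro tendsto_intros)
  then have "filterlim ((*) a) (at z) (at (z / a))"
    using assms by (intro filterlim_atI) (auto simp: eventually_at_filter field_simps)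
  ultimately show "\<forall>\<^sub>F x in at (z / a). P (a * x)"
    by (rule eventually_compose_filterlim)
qed

lemma peak_rescale:
  fixes f :: "real \<Rightarrow> real"
  assumes "\<rho> > 0"
  shows "local_peak (\<lambda>\<omega>. f (\<rho> * \<omega>)) (\<omega>\<^sub>0 / \<rho>) \<longleftrightarrow> local_peak f \<omega>\<^sub>0"
    and "strict_local_peak (\<lambda>\<omega>. f (\<rho> * \<omega>)) (\<omega>\<^sub>0 / \<rho>) \<longleftrightarrow> strict_local_peak f \<omega>\<^sub>0"
    and "global_peak (\<lambda>\<omega>. f (\<rho> * \<omega>)) (\<omega>\<^sub>0 / \<rho>) \<longleftrightarrow> global_peak f \<omega>\<^sub>0"
proof -
  show "local_peak (\<lambda>\<omega>. f (\<rho> * \<omega>)) (\<omega>\<^sub>0 / \<rho>) \<longleftrightarrow> local_peak f \<omega>\<^sub>0"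
    using assms eventually_at_rescale[of \<rho> "\<lambda>y. f y \<le> f \<omega>\<^sub>0"] by (simp add: local_peak_def)
  show "strict_local_peak (\<lambda>\<omega>. f (\<rho> * \<omega>)) (\<omega>\<^sub>0 / \<rho>) \<longleftrightarrow> strict_local_peak f \<omega>\<^sub>0"
    using assms eventually_at_rescale[of \<rho> "\<lambda>y. f y < f \<omega>\<^sub>0"] by (simp add: strict_local_peak_def)
  have "(\<forall>\<omega>. f (\<rho> * \<omega>) \<le> f \<omega>\<^sub>0) \<longleftrightarrow> (\<forall>\<omega>. f \<omega> \<le> f \<omega>\<^sub>0)"
  proof (intro iffI allI)
    fix \<omega> assume "\<forall>\<omega>. f (\<rho> * \<omega>) \<le> f \<omega>\<^sub>0"
    \<comment> \<open>Every frequency is attained by the dilation, so the bound extends to the whole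
      line.\<close>
    from spec[OF this, of "\<omega> / \<rho>"] show "f \<omega> \<le> f \<omega>\<^sub>0"
      using assms by simp
  qed simp
  then show "global_peak (\<lambda>\<omega>. f (\<rho> * \<omega>)) (\<omega>\<^sub>0 / \<rho>) \<longleftrightarrow> global_peak f \<omega>\<^sub>0"
    using assms by (simp add: global_peak_def)
qed

theorem theorem34:
  fixes M :: "'w measure"
    and s\<^sub>1 s\<^sub>2 :: "'w random_source"
    and S\<^sub>1 S\<^sub>2 :: "real^3 \<Rightarrow> real \<Rightarrow> real"
    and R :: "real^3^3"
    and c K \<rho> :: real
  assumes "c > 0" and "K > 0" and "\<rho> > 0" and "rotation_matrix R"
    and "prob_space M"
    and "stationary_source M s\<^sub>1"
    and "integrable lborel (correlation M s\<^sub>1)"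
    and "s\<^sub>2 = holonomy_act \<rho> R s\<^sub>1"
    and "sonic_far_field c K (spectrum M s\<^sub>1) S\<^sub>1"
    and "sonic_far_field c K (spectrum M s\<^sub>2) S\<^sub>2"
  shows "(\<forall>n \<omega>. norm n = 1 \<longrightarrow>
           directivity S\<^sub>2 n \<omega> = directivity S\<^sub>1 (transpose R *v n) (\<rho> * \<omega>)) \<and>
         (\<forall>n \<omega>\<^sub>0. norm n = 1 \<longrightarrow>
           (local_peak (directivity S\<^sub>1 (transpose R *v n)) \<omega>\<^sub>0
              \<longleftrightarrow> local_peak (directivity S\<^sub>2 n) (\<omega>\<^sub>0 / \<rho>)) \<and>
           (strict_local_peak (directivity S\<^sub>1 (transpose R *v n)) \<omega>\<^sub>0
              \<longleftrightarrow> strict_local_peak (directivity S\<^sub>2 n) (\<omega>\<^sub>0 / \<rho>)) \<and>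
           (global_peak (directivity S\<^sub>1 (transpose R *v n)) \<omega>\<^sub>0
              \<longleftrightarrow> global_peak (directivity S\<^sub>2 n) (\<omega>\<^sub>0 / \<rho>)))"
proof -
  have orth: "orthogonal_matrix R"
    using assms(4) by (simp add: rotation_matrix_def)
  have meas: "correlation M s\<^sub>1 \<in> borel_measurable borel"
    using borel_measurable_integrable[OF assms(7)] by simp
  have main: "directivity S\<^sub>2 n \<omega> = directivity S\<^sub>1 (transpose R *v n) (\<rho> * \<omega>)"
    if n: "norm n = 1" for n \<omega>
  proof -
    have "orthogonal_transformation ((*v) (transpose R))"
      using orth by (simp add: orthogonal_transformation_matrix matrix_vector_mul_linear)
    \<comment> \<open>The far-field relation concerns unit directions only. In the rotated
      direction, \<open>\<rho> *\<^sub>R (transpose R *v k)\<close> with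
      \<open>k = (\<omega> / c) *\<^sub>R n\<close> is precisely the sonic wavevector at frequency
      \<open>\<rho> * \<omega>\<close>.\<close>
    then have "norm (transpose R *v n) = 1"
      using n by (simp only: orthogonal_transformation_norm)
    then show ?thesis
      using n \<open>\<rho> > 0\<close> assms(8)
      by (simp add: directivity_sonic[OF assms(9)] directivity_sonic[OF assms(10)]
          spectrum_holonomy_act[OF assms(3) orth assms(6) meas] matrix_vector_mult_scaleR)
  qed
  \<comment> \<open>As an identity of functions of frequency, this presents the second directivity
    as a dilation of the first, the form in which peaks are compared.\<close>
  have "directivity S\<^sub>2 n = (\<lambda>\<omega>. directivity S\<^sub>1 (transpose R *v n) (\<rho> * \<omega>))"
    if "norm n = 1" for n
    using main[OF that] by (intro ext)
  then show ?thesis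
    using main \<open>\<rho> > 0\<close> by (simp add: peak_rescale)
qed

end
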